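(* For $d>0$ consider the system, for sequences $(u_n,v_n)_{n\ge0}$ in $(0,\infty)^2$, $$u_{n+1}u_n=1+\frac{d}{v_n},\qquad v_{n+1}v_n=1+\frac{d}{u_{n+1}}.$$ Every integer $q\geq 11$ is the minimal period of some solution of this system for some $d>0$. Among the integers between $2$ and $10$: the integers $2,3,4,6,10$ are the minimal period of no non-constant solution, for any $d>0$; and each of the others, $5,7,8,9$, is the minimal period of some solution for some $d>0$.
   Context: A solution has minimal period $q$ if $(u_{n+q},v_{n+q})=(u_n,v_n)$ for all $n\geq0$ and $q$ is the least positive integer with this property. *)

theory Defs
  imports "HOL-Analysis.Analysis"
begin

definition solution :: "real \<Rightarrow> (nat \<Rightarrow> real) \<Rightarrow> (nat \<Rightarrow> real) \<Rightarrow> bool" where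
  "solution d u v \<longleftrightarrow>
     (\<forall>n. u n > 0 \<and> v n > 0) \<and>
     (\<forall>n. u (Suc n) * u n = 1 + d / v n) \<and>
     (\<forall>n. v (Suc n) * v n = 1 + d / u (Suc n))"

definition has_period :: "nat \<Rightarrow> (nat \<Rightarrow> 'a) \<Rightarrow> bool" where
  "has_period q x \<longleftrightarrow> q > 0 \<and> (\<forall>n. x (n + q) = x n)"

definition minimal_period :: "nat \<Rightarrow> (nat \<Rightarrow> 'a) \<Rightarrow> bool" where
  "minimal_period q x \<longleftrightarrow> has_period q x \<and> (\<forall>p. has_period p x \<longrightarrow> q \<le> p)"

end

theory Submission
  imports Defs
begin

text \<open>
  Listing a solution as \<open>w = u\<^sub>0, v\<^sub>0, u\<^sub>1, v\<^sub>1, \<dots>\<close> turns the system into the single recurrence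
  \<open>w\<^sub>k\<^sub>+\<^sub>2 w\<^sub>k = 1 + d / w\<^sub>k\<^sub>+\<^sub>1\<close>, and a period \<open>q\<close> of the solution into a period \<open>2q\<close> of \<open>w\<close>. The
  orbits of the recurrence turn around its equilibrium by strictly more than a quarter and strictly
  less than a third of a turn per step. An orbit that makes \<open>p\<close> turns in \<open>2q\<close> steps therefore has
  \<open>q/2 < p < 2q/3\<close>. The integers \<open>q\<close> for which such a \<open>p\<close> exists that is also prime to \<open>q\<close> are
  exactly \<open>5, 7, 8, 9\<close> and those from \<open>11\<close> on. The proof makes both directions precise without
  rotation numbers or the invariant curves of the recurrence.

  \<^emph>\<open>Exclusion.\<close> In logarithmic coordinates the difference \<open>D\<close> of two orbits satisfies
  \<open>D\<^sub>k + D\<^sub>k\<^sub>+\<^sub>2 = - c\<^sub>k D\<^sub>k\<^sub>+\<^sub>1\<close> with \<open>0 < c\<^sub>k < 1\<close>, so it oscillates faster than a sequence of period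
  \<open>4\<close> (all \<open>c\<^sub>k = 0\<close>) and slower than one of period \<open>3\<close> (all \<open>c\<^sub>k = 1\<close>). If \<open>w\<close> has period \<open>2n\<close>, the
  difference between \<open>w\<close> and its shift by \<open>n\<close> changes sign after \<open>n\<close> steps, hence makes a half-odd
  number of turns in \<open>n\<close> steps. For \<open>n \<in> {1, 2, 3, 4, 6, 10}\<close> no half-odd number lies strictly
  between \<open>n/4\<close> and \<open>n/3\<close>, so the difference vanishes (\<open>antiperiodic_oscillating_zero\<close>) and \<open>w\<close> even
  has period \<open>n\<close> (\<open>orbit_half_period\<close>). Iterating this, and treating period \<open>3\<close> of \<open>w\<close> by itself,
  makes a solution of period \<open>2\<close>, \<open>3\<close>, \<open>4\<close> or \<open>6\<close> constant and gives a solution of period \<open>10\<close> the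
  period \<open>5\<close>.

  \<^emph>\<open>Existence.\<close> The recurrence is reversible: an orbit with \<open>w\<^sub>0 = w\<^sub>1\<close> and \<open>w\<^sub>q = w\<^sub>q\<^sub>+\<^sub>1\<close> is
  symmetric about two points at distance \<open>q\<close> and so has period \<open>2q\<close> (\<open>orbit_symmetric_period\<close>). At
  the equilibrium the linearized recurrence is a rotation by an angle \<open>\<phi>\<close>, which sweeps
  \<open>(\<pi>/2, 2\<pi>/3)\<close> as \<open>d\<close> varies. For an orbit starting symmetrically at a small distance \<open>\<epsilon>\<close> from the
  equilibrium, \<open>w\<^sub>q\<^sub>+\<^sub>1 - w\<^sub>q\<close> is to first order in \<open>\<epsilon>\<close> a negative multiple of \<open>sin (q \<phi>)\<close>, and this
  changes sign at \<open>\<phi> = \<pi> p / q\<close>. With \<open>\<epsilon>\<close> fixed, the intermediate value theorem in \<open>\<phi>\<close> gives an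
  orbit of period \<open>2q\<close> (\<open>minimal_period_near_rotation\<close>). It is so close to the rotation by \<open>\<pi> p / q\<close>
  that, \<open>p\<close> being prime to \<open>q\<close>, it cannot close up after \<open>2r\<close> steps with \<open>r < q\<close>.
\<close>

section \<open>Reduction to a scalar recurrence\<close>

definition orbit :: "real \<Rightarrow> (nat \<Rightarrow> real) \<Rightarrow> bool" where
  "orbit d w \<longleftrightarrow> (\<forall>k. w k > 0) \<and> (\<forall>k. w (k + 2) * w k = 1 + d / w (k + 1))"

lemma orbit_rec: "orbit d w \<Longrightarrow> w (k + 2) * w k = 1 + d / w (k + 1)"
  by (simp add: orbit_def)

lemma orbit_shift: "orbit d w \<Longrightarrow> orbit d (\<lambda>k. w (k + n))"
  unfolding orbit_def by (metis add.assoc add.commute)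

definition interleave :: "(nat \<Rightarrow> 'a) \<Rightarrow> (nat \<Rightarrow> 'a) \<Rightarrow> nat \<Rightarrow> 'a" where
  "interleave u v k = (if even k then u (k div 2) else v (k div 2))"

lemma interleave_even [simp]: "interleave u v (2 * n) = u n"
  and interleave_odd [simp]: "interleave u v (Suc (2 * n)) = v n"
  by (simp_all add: interleave_def)

lemma interleave_split: "interleave (\<lambda>n. w (2 * n)) (\<lambda>n. w (Suc (2 * n))) = w"
  by (rule ext) (auto simp: interleave_def elim: oddE)

lemma all_nat_even_odd: "(\<forall>k::nat. P k) \<longleftrightarrow> (\<forall>n. P (2 * n)) \<and> (\<forall>n. P (Suc (2 * n)))"
  by (metis evenE oddE Suc_eq_plus1)

lemma solution_iff_orbit: "solution d u v \<longleftrightarrow> orbit d (interleave u v)"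
proof -
  have e: "interleave u v (2 * n + 2) = u (Suc n)" "interleave u v (2 * n + 1) = v n"
    "interleave u v (Suc (2 * n) + 2) = v (Suc n)" "interleave u v (Suc (2 * n) + 1) = u (Suc n)" for n
    by (simp_all add: interleave_def)
  show ?thesis
    unfolding orbit_def solution_def
    by (subst (1 2) all_nat_even_odd) (auto simp only: e interleave_even interleave_odd)
qed

lemma has_period_interleave_iff:
  "has_period (2 * q) (interleave u v) \<longleftrightarrow> has_period q (\<lambda>n. (u n, v n))"
proof -
  have e: "interleave u v (2 * n + 2 * q) = u (n + q)"
    "interleave u v (Suc (2 * n) + 2 * q) = v (n + q)" for n
    by (simp_all add: interleave_def)
  show ?thesis
    unfolding has_period_def
    by (subst all_nat_even_odd) (auto simp only: e interleave_even interleave_odd prod.inject)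
qed

section \<open>Oscillation of the difference of two orbits\<close>

text \<open>
  A variable-coefficient linear recurrence lying strictly between the rotation by a quarter turn
  (\<open>c = 0\<close>) and the rotation by a third of a turn (\<open>c = 1\<close>). The coefficient may depend on the index.
\<close>

definition oscillating :: "(nat \<Rightarrow> real) \<Rightarrow> bool" where
  "oscillating D \<longleftrightarrow> (\<forall>k. \<exists>c. 0 < c \<and> c < 1 \<and> D k + D (k + 2) = - c * D (k + 1))"

lemma orbit_ln_step:
  assumes "orbit d w"
  shows "ln (w k) + ln (w (k + 2)) = ln (1 + d / w (k + 1))"
  using assms unfolding orbit_def by (metis ln_mult mult.commute less_imp_neq)

text \<open>
  As a function of \<open>ln x\<close>, the right-hand side \<open>ln (1 + d / x)\<close> of the recurrence is decreasing because
  \<open>1 + d / x\<close> decreases, and has slope above \<open>-1\<close> because \<open>x (1 + d / x) = x + d\<close> increases.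
\<close>

lemma ln_reaction_contracts:
  fixes d x y :: real
  assumes "d > 0" "0 < x" "x < y"
  shows "ln (1 + d / y) < ln (1 + d / x)"
    and "ln (1 + d / x) - ln (1 + d / y) < ln y - ln x"
proof -
  show "ln (1 + d / y) < ln (1 + d / x)"
    using assms by (simp add: frac_less2 add_pos_pos)
  have "ln (1 + d / t) + ln t = ln (t + d)" if "t > 0" for t
  proof -
    have "1 + d / t > 0" "(1 + d / t) * t = t + d"
      using that \<open>d > 0\<close> by (simp_all add: add_pos_pos field_simps)
    then show ?thesis
      using that by (metis ln_mult_pos)
  qed
  from this[of x] this[of y] have "ln (1 + d / x) + ln x = ln (x + d)" "ln (1 + d / y) + ln y = ln (y + d)"
    using assms by auto
  moreover have "ln (x + d) < ln (y + d)"
    using assms by simp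
  ultimately show "ln (1 + d / x) - ln (1 + d / y) < ln y - ln x"
    by linarith
qed

lemma oscillating_difference:
  assumes "d > 0" and w: "orbit d w" and w': "orbit d w'"
  shows "oscillating (\<lambda>k. ln (w' k) - ln (w k))"
  unfolding oscillating_def
proof
  fix k
  define x y where "x = w (k + 1)" and "y = w' (k + 1)"
  define R where "R = ln (1 + d / y) - ln (1 + d / x)"
  have pos: "x > 0" "y > 0"
    using w w' by (auto simp: orbit_def x_def y_def)
  have sum: "(ln (w' k) - ln (w k)) + (ln (w' (k + 2)) - ln (w (k + 2))) = R"
    using orbit_ln_step[OF w, of k] orbit_ln_step[OF w', of k] by (simp add: R_def x_def y_def)
  \<comment> \<open>The coefficient is minus the slope of a chord of the right-hand side; if the two orbits agree
    at \<open>k + 1\<close>, any value will do.\<close>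
  have "\<exists>c. 0 < c \<and> c < 1 \<and> R = - c * (ln y - ln x)"
  proof (cases "x = y")
    case True
    then show ?thesis by (intro exI[of _ "1 / 2"]) (simp add: R_def)
  next
    case False
    have "0 < - R / (ln y - ln x) \<and> - R / (ln y - ln x) < 1"
    proof (cases "x < y")
      case True
      then show ?thesis
        using ln_reaction_contracts[OF \<open>d > 0\<close> pos(1) True] pos by (simp add: R_def field_simps)
    next
      case False
      with \<open>x \<noteq> y\<close> have "y < x" by simp
      then show ?thesis
        using ln_reaction_contracts[OF \<open>d > 0\<close> pos(2) \<open>y < x\<close>] pos by (simp add: R_def field_simps)
    qed
    moreover have "R = - (- R / (ln y - ln x)) * (ln y - ln x)"
      using False pos by simp
    ultimately show ?thesis by blast
  qed
  then show "\<exists>c. 0 < c \<and> c < 1 \<and>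
      ln (w' k) - ln (w k) + (ln (w' (k + 2)) - ln (w (k + 2)))
        = - c * (ln (w' (k + 1)) - ln (w (k + 1)))"
    by (simp only: sum x_def y_def)
qed

lemma oscillating_signs:
  assumes "oscillating D"
  shows "D (k + 1) > 0 \<Longrightarrow> - D (k + 1) < D k + D (k + 2) \<and> D k + D (k + 2) < 0"
    and "D (k + 1) < 0 \<Longrightarrow> 0 < D k + D (k + 2) \<and> D k + D (k + 2) < - D (k + 1)"
    and "D (k + 1) = 0 \<Longrightarrow> D (k + 2) = - D k"
proof -
  obtain c where c: "0 < c" "c < 1" "D k + D (k + 2) = - c * D (k + 1)"
    using assms unfolding oscillating_def by blast
  show "- D (k + 1) < D k + D (k + 2) \<and> D k + D (k + 2) < 0" if "D (k + 1) > 0"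
    using c that by simp
  show "0 < D k + D (k + 2) \<and> D k + D (k + 2) < - D (k + 1)" if "D (k + 1) < 0"
    using c that by (simp add: mult_less_0_iff mult_less_cancel_right1)
  show "D (k + 2) = - D k" if "D (k + 1) = 0"
    using c that by simp
qed

text \<open>
  The two prohibitions say that blocks of equal signs have length \<open>1\<close> or \<open>2\<close> and that no two blocks of
  length \<open>1\<close> are adjacent. Over \<open>n\<close> steps there is an odd number \<open>s\<close> of blocks, and \<open>n/2 \<le> s \<le> 2n/3\<close>.
  For \<open>n = 1, 3, 4\<close> that leaves no odd \<open>s\<close>, and for \<open>n = 2, 6, 10\<close> only \<open>s = n/2\<close>, where all blocks
  have length \<open>2\<close> and the conclusion holds. The signs of \<open>n\<close>
  consecutive entries determine the rest, so this is a finite propositional problem.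
\<close>

lemma antiperiodic_sign_pattern:
  fixes b :: "nat \<Rightarrow> bool"
  assumes n: "n \<in> {1, 2, 3, 4, 6, 10}"
    and anti: "\<And>k. b (k + n) \<longleftrightarrow> \<not> b k"
    and no3: "\<And>k. \<not> (b k = b (k + 1) \<and> b (k + 1) = b (k + 2))"
    and no4: "\<And>k. \<not> (b k \<noteq> b (k + 1) \<and> b (k + 1) \<noteq> b (k + 2) \<and> b (k + 2) \<noteq> b (k + 3))"
  shows "b (k + 2) \<longleftrightarrow> \<not> b k"
proof -
  define a where "a i = b (k + i)" for i
  have 3: "\<not> (a i = a (i + 1) \<and> a (i + 1) = a (i + 2))"
   and 4: "\<not> (a i \<noteq> a (i + 1) \<and> a (i + 1) \<noteq> a (i + 2) \<and> a (i + 2) \<noteq> a (i + 3))"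
   and A: "a (i + n) \<longleftrightarrow> \<not> a i" for i
    using no3[of "k + i"] no4[of "k + i"] anti[of "k + i"] by (simp_all add: a_def add.assoc)
  have "a 2 \<longleftrightarrow> \<not> a 0"
    using n 3[of 0] 3[of 1] 3[of 2] 3[of 3] 3[of 4] 3[of 5] 3[of 6] 3[of 7] 3[of 8] 3[of 9]
      4[of 0] 4[of 1] 4[of 2] 4[of 3] 4[of 4] 4[of 5] 4[of 6] 4[of 7] 4[of 8] 4[of 9]
      A[of 0] A[of 1] A[of 2] A[of 3]
    by (elim insertE emptyE; simp add: numeral_eq_Suc; sat)
  then show ?thesis by (simp add: a_def)
qed

text \<open>
  The signs of a nonzero \<open>D\<close> must have the pattern \<open>+ + - -\<close> of period \<open>4\<close> by the preceding lemma.
  This borderline case is excluded by comparing \<open>D\<close> with its own sign sequence \<open>P\<close>, a solution of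
  \<open>P\<^sub>k + P\<^sub>k\<^sub>+\<^sub>2 = 0\<close>: the Casoratian of the two never decreases because \<open>c > 0\<close>, and it is periodic
  because both sequences change sign after \<open>n\<close> steps. So it is constant, which forces \<open>D = 0\<close>.
\<close>

lemma antiperiodic_oscillating_zero:
  assumes n: "n \<in> {1, 2, 3, 4, 6, 10}"
    and osc: "oscillating D" and anti: "\<And>k. D (k + n) = - D k"
  shows "D k = 0"
proof (rule ccontr)
  assume "D k \<noteq> 0"
  note signs = oscillating_signs[OF osc]
  \<comment> \<open>Two consecutive zeros would make all later entries vanish, but \<open>\<bar>D k\<bar>\<close> recurs forever.\<close>
  have nz: "D i \<noteq> 0 \<or> D (i + 1) \<noteq> 0" for i
  proof (rule ccontr)
    assume "\<not> (D i \<noteq> 0 \<or> D (i + 1) \<noteq> 0)"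
    then have "D (i + j) = 0 \<and> D (i + j + 1) = 0" for j
      by (induction j) (use signs(3) in \<open>auto simp: add.assoc\<close>)
    moreover have "\<bar>D (k + n * m)\<bar> = \<bar>D k\<bar>" for m
    proof (induction m)
      case (Suc m)
      then show ?case using anti[of "k + n * m"] by (simp add: algebra_simps)
    qed simp
    moreover have "i \<le> k + n * i"
      using n by auto
    then obtain j where "k + n * i = i + j"
      using le_Suc_ex by blast
    ultimately have "\<bar>D k\<bar> = 0"
      by (metis abs_zero)
    then show False using \<open>D k \<noteq> 0\<close> by simp
  qed
  \<comment> \<open>\<open>b i\<close> is the sign of \<open>D (i + 1)\<close>, where a zero inherits the sign of its predecessor; with this
    choice the prohibited patterns stay impossible in the presence of zeros.\<close>
  define b where "b i \<longleftrightarrow> D (i + 1) > 0 \<or> D (i + 1) = 0 \<and> D i > 0" for i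
  have b_pos: "D (i + 1) \<ge> 0 \<and> (D (i + 1) = 0 \<longrightarrow> D i > 0)" if "b i" for i
    using that by (auto simp: b_def)
  have b_neg: "D (i + 1) \<le> 0 \<and> (D (i + 1) = 0 \<longrightarrow> D i < 0)" if "\<not> b i" for i
    using that nz[of i] by (auto simp: b_def)
  have b_anti: "b (i + n) \<longleftrightarrow> \<not> b i" for i
    using anti[of i] anti[of "i + 1"] nz[of i] by (auto simp: b_def ac_simps)
  have b2: "b (i + 2) \<longleftrightarrow> \<not> b i" for i
  proof (rule antiperiodic_sign_pattern[OF n])
    show "b (i + n) \<longleftrightarrow> \<not> b i" for i
      by (rule b_anti)
    show "\<not> (b i = b (i + 1) \<and> b (i + 1) = b (i + 2))" for i
      using b_pos[of i] b_pos[of "i + 1"] b_pos[of "i + 2"] b_neg[of i] b_neg[of "i + 1"] b_neg[of "i + 2"]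
        signs[of "i + 1"] by (simp add: numeral_eq_Suc) (smt (verit))
    show "\<not> (b i \<noteq> b (i + 1) \<and> b (i + 1) \<noteq> b (i + 2) \<and> b (i + 2) \<noteq> b (i + 3))" for i
      using b_pos[of i] b_pos[of "i + 1"] b_pos[of "i + 2"] b_pos[of "i + 3"]
        b_neg[of i] b_neg[of "i + 1"] b_neg[of "i + 2"] b_neg[of "i + 3"]
        signs[of "i + 1"] signs[of "i + 2"] by (simp add: numeral_eq_Suc) (smt (verit))
  qed
  define P :: "nat \<Rightarrow> real" where "P i = (if b i then 1 else -1)" for i
  have P2: "P (i + 2) = - P i" for i
    using b2[of i] by (simp add: P_def)
  have P_abs: "P i * D (i + 1) = \<bar>D (i + 1)\<bar>" for i
    using b_pos[of i] b_neg[of i] by (auto simp: P_def)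
  \<comment> \<open>The Casoratian \<open>P\<^sub>i D\<^sub>i - P\<^sub>i\<^sub>-\<^sub>1 D\<^sub>i\<^sub>+\<^sub>1\<close>, rewritten with \<open>P\<^sub>i\<^sub>-\<^sub>1 = - P\<^sub>i\<^sub>+\<^sub>1\<close> so that no index
    precedes \<open>i\<close>.\<close>
  define T where "T i = P i * D i + P (i + 1) * D (i + 1)" for i
  have T_step: "T (i + 1) - T i = - P i * (D i + D (i + 2))" for i
    using P2[of i] by (simp add: T_def algebra_simps)
  have mono: "T i \<le> T (i + 1)" for i
  proof -
    obtain c where c: "0 < c" "D i + D (i + 2) = - c * D (i + 1)"
      using osc unfolding oscillating_def by blast
    have "T (i + 1) - T i = c * \<bar>D (i + 1)\<bar>"
      unfolding T_step c(2) P_abs[symmetric] by simp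
    then show ?thesis using c(1) by (simp add: algebra_simps)
  qed
  have "T (i + n) = T i" for i
    using anti[of i] anti[of "i + 1"] b_anti[of i] b_anti[of "i + 1"] by (simp add: T_def P_def ac_simps)
  moreover have "T (i + 1) \<le> T (i + n)" for i
    using lift_Suc_mono_le[of T "i + 1" "i + n"] mono n by auto
  ultimately have const: "T (i + 1) = T i" for i
    using mono[of i] by (simp add: order_antisym)
  have "D (i + 1) = 0" for i
  proof -
    have "D i + D (i + 2) = 0"
      using T_step[of i] const[of i] by (simp add: P_def split: if_splits)
    then show ?thesis
      using signs(1,2)[of i] by (cases "D (i + 1)" "0 :: real" rule: linorder_cases) simp_all
  qed
  then show False
    using nz[of "0 + 1"] by metis
qed


text \<open>The shift of an orbit is an orbit, and a period \<open>2n\<close> makes the difference to the shift by \<open>n\<close>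
  antiperiodic.\<close>

lemma orbit_half_period:
  assumes "d > 0" "orbit d w" and n: "n \<in> {1, 2, 3, 4, 6, 10}" and per: "has_period (2 * n) w"
  shows "has_period n w"
proof -
  define D where "D k = ln (w (k + n)) - ln (w k)" for k
  have "oscillating D"
    unfolding D_def using assms(1,2) by (intro oscillating_difference orbit_shift)
  moreover have "D (k + n) = - D k" for k
    using per by (simp add: D_def has_period_def add.assoc flip: mult_2)
  ultimately have "D k = 0" for k
    by (rule antiperiodic_oscillating_zero[OF n])
  then have "w (k + n) = w k" for k
    using \<open>orbit d w\<close> by (simp add: D_def orbit_def)
  then show ?thesis
    using n by (auto simp: has_period_def)
qed

text \<open>
  The increments of a sequence of period \<open>3\<close> sum to zero over any three consecutive indices, which is
  the recurrence with \<open>c = 1\<close>; but oscillation requires \<open>c < 1\<close>.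
\<close>

lemma orbit_period_3:
  assumes "d > 0" "orbit d w" and per: "has_period 3 w"
  shows "has_period 1 w"
proof -
  define D where "D k = ln (w (k + 1)) - ln (w k)" for k
  have osc: "oscillating D"
    unfolding D_def using assms(1,2) by (intro oscillating_difference orbit_shift)
  have "D (k + 1) = 0" for k
  proof -
    obtain c where "c < 1" "D k + D (k + 2) = - c * D (k + 1)"
      using osc unfolding oscillating_def by blast
    moreover have "D k + D (k + 1) + D (k + 2) = 0"
      using per by (simp add: D_def has_period_def numeral_3_eq_3)
    ultimately have "(1 - c) * D (k + 1) = 0"
      unfolding left_diff_distrib by linarith
    then show ?thesis using \<open>c < 1\<close> by simp
  qed
  then have step: "w (k + 2) = w (k + 1)" for k
    using \<open>orbit d w\<close> by (simp add: D_def orbit_def)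
  have "w (k + 1) = w k" for k
  proof -
    have "w (k + 3) = w k"
      using per by (simp add: has_period_def)
    then show ?thesis
      using step[of k] step[of "k + 1"] by (simp add: numeral_3_eq_3)
  qed
  then show ?thesis
    by (simp add: has_period_def)
qed

text \<open>
  Periods of the interleaved orbit descend \<open>4, 2\<close> for \<open>q = 2\<close>, \<open>6, 3, 1\<close> for \<open>q = 3\<close>, \<open>8, 4, 2\<close> for
  \<open>q = 4\<close>, \<open>12, 6, 3, 1\<close> for \<open>q = 6\<close>, and \<open>20, 10\<close> for \<open>q = 10\<close>. Period \<open>2\<close> of the orbit already means a constant solution.
\<close>

lemma solution_excluded_periods:
  assumes "d > 0" "solution d u v" "has_period q (\<lambda>n. (u n, v n))" "q \<in> {2, 3, 4, 6, 10}"
  shows "has_period (if q = 10 then 5 else 1) (\<lambda>n. (u n, v n))"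
proof -
  define w where "w = interleave u v"
  have w: "orbit d w" and per: "has_period (2 * q) w"
    using assms by (simp_all add: w_def has_period_interleave_iff flip: solution_iff_orbit)
  note half = orbit_half_period[OF \<open>d > 0\<close> w]
  have h2: "has_period 2 w" if "has_period 4 w"
    using half[of 2] that by simp
  have "has_period (2 * (if q = 10 then 5 else 1)) w"
    using \<open>q \<in> _\<close>
  proof (elim insertE emptyE)
    assume "q = 3"
    then have "has_period 1 w"
      using half[of 3] orbit_period_3[OF \<open>d > 0\<close> w] per by simp
    then show ?thesis using \<open>q = 3\<close> by (simp add: has_period_def)
  next
    assume "q = 6"
    then have "has_period 1 w"
      using half[of 3] half[of 6] orbit_period_3[OF \<open>d > 0\<close> w] per by simp
    then show ?thesis using \<open>q = 6\<close> by (simp add: has_period_def)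
  qed (use per half[of 4] half[of 10] h2 in simp_all)
  then show ?thesis
    by (simp only: w_def has_period_interleave_iff)
qed

section \<open>Reversibility\<close>

lemma orbit_determined:
  assumes w: "orbit d w" and w': "orbit d w'" and "w' 0 = w 0" "w' 1 = w 1"
  shows "w' = w"
proof
  fix k
  show "w' k = w k"
  proof (induction k rule: induct_nat_012)
    case (ge2 k)
    have "w k > 0" using w by (simp add: orbit_def)
    moreover have "w' (k + 2) * w k = w (k + 2) * w k"
      using orbit_rec[OF w, of k] orbit_rec[OF w', of k] ge2 by simp
    ultimately show ?case by simp
  qed (use assms in simp_all)
qed

text \<open>
  The recurrence is unchanged when the order of its three terms is reversed, so two equal consecutive
  values make the orbit symmetric about the midpoint between them.
\<close>

lemma orbit_reflection:
  assumes w: "orbit d w" and "w (q + 1) = w q" and "j \<le> q"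
  shows "w (q + 1 + j) = w (q - j)"
  using \<open>j \<le> q\<close>
proof (induction j rule: induct_nat_012)
  case 1
  then obtain m where q: "q = Suc m" by (cases q) auto
  have eq: "w (m + 2) = w (m + 1)" and "w (m + 1) > 0"
    using w \<open>w (q + 1) = w q\<close> by (simp_all add: q orbit_def)
  have "w (m + 3) * w (m + 1) = 1 + d / w (m + 2)" "w (m + 2) * w m = 1 + d / w (m + 1)"
    using orbit_rec[OF w, of "m + 1"] orbit_rec[OF w, of m] by (simp_all add: numeral_3_eq_3)
  then have "w (m + 3) = w m"
    using eq \<open>w (m + 1) > 0\<close> by (metis less_irrefl mult.commute mult_left_cancel)
  then show ?case by (simp add: q numeral_3_eq_3)
next
  case (ge2 j)
  then obtain m where q: "q = m + j + 2"
    by (metis ge2.prems add.commute add_2_eq_Suc le_Suc_ex add.assoc)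
  have IH: "w (q + 1 + j) = w (m + 2)" "w (q + 1 + j + 1) = w (m + 1)"
    using ge2 by (simp_all add: q)
  have "w (q + 1 + j + 2) * w (q + 1 + j) = w (m + 2) * w m"
    using orbit_rec[OF w, of "q + 1 + j"] orbit_rec[OF w, of m] IH by simp
  moreover have "w (m + 2) > 0"
    using w by (simp add: orbit_def)
  ultimately show ?case
    using IH by (simp add: q)
qed (use assms in simp)

text \<open>
  The composition of the reflections about \<open>1/2\<close> and about \<open>q + 1/2\<close> is the translation by \<open>2q\<close>.
\<close>

lemma orbit_symmetric_period:
  assumes w: "orbit d w" and "w 1 = w 0" "w (q + 1) = w q" "q > 0"
  shows "has_period (2 * q) w"
proof -
  have "w (0 + 2 * q) = w 0" "w (1 + 2 * q) = w 1"
    using orbit_reflection[OF w \<open>w (q + 1) = w q\<close>, of q]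
      orbit_reflection[OF w \<open>w (q + 1) = w q\<close>, of "q - 1"] assms(2,4)
    by (simp_all add: mult_2)
  then have "(\<lambda>k. w (k + 2 * q)) = w"
    by (intro orbit_determined[OF w orbit_shift[OF w]])
  then show ?thesis
    using \<open>q > 0\<close> by (simp add: has_period_def fun_eq_iff)
qed

section \<open>Symmetric orbits near the equilibrium\<close>

text \<open>
  The recurrence measured in units of its equilibrium \<open>l\<close>, which satisfies \<open>l\<^sup>3 = l + d\<close>, with the
  parameter \<open>d\<close> replaced by the angle \<open>\<phi>\<close> of the linearization at the equilibrium. The latter is
  \<open>x\<^sub>k\<^sub>+\<^sub>2 + (d / l\<^sup>3) x\<^sub>k\<^sub>+\<^sub>1 + x\<^sub>k = 0\<close>, so \<open>- 2 cos \<phi> = d / l\<^sup>3 = 1 - 1 / l\<^sup>2\<close>, and \<open>d > 0\<close> corresponds to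
  \<open>\<phi>\<close> between \<open>\<pi>/2\<close> and \<open>2\<pi>/3\<close>. Both initial values are \<open>1 + \<epsilon>\<close>, so that the orbit is symmetric
  about \<open>1/2\<close>.
\<close>

fun perturbed :: "real \<Rightarrow> real \<Rightarrow> nat \<Rightarrow> real" where
  "perturbed \<phi> \<epsilon> 0 = 1 + \<epsilon>"
| "perturbed \<phi> \<epsilon> (Suc 0) = 1 + \<epsilon>"
| "perturbed \<phi> \<epsilon> (Suc (Suc k)) =
     (1 + 2 * cos \<phi> - 2 * cos \<phi> / perturbed \<phi> \<epsilon> (Suc k)) / perturbed \<phi> \<epsilon> k"

lemma cos_bounds:
  assumes "\<phi> \<in> {pi / 2<..<2 * pi / 3}"
  shows "cos \<phi> < 0" "1 + 2 * cos \<phi> > 0"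
proof -
  show "cos \<phi> < 0"
    using assms cos_monotone_0_pi[of "pi / 2" \<phi>] by simp
  show "1 + 2 * cos \<phi> > 0"
    using assms cos_monotone_0_pi[of \<phi> "2 * pi / 3"] by (simp add: cos_120)
qed

lemma perturbed_pos:
  assumes \<phi>: "\<phi> \<in> {pi / 2<..<2 * pi / 3}" and "\<epsilon> > 0"
  shows "perturbed \<phi> \<epsilon> k > 0"
proof (induction k rule: induct_nat_012)
  case (ge2 k)
  then have "2 * cos \<phi> / perturbed \<phi> \<epsilon> (Suc k) < 0"
    using cos_bounds[OF \<phi>] by (simp add: divide_neg_pos)
  then show ?case
    using ge2 cos_bounds[OF \<phi>] by simp
qed (use \<open>\<epsilon> > 0\<close> in simp_all)

lemma orbit_perturbed:
  assumes \<phi>: "\<phi> \<in> {pi / 2<..<2 * pi / 3}" and "\<epsilon> > 0"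
  defines "l \<equiv> 1 / sqrt (1 + 2 * cos \<phi>)"
  shows "orbit (- 2 * cos \<phi> * l ^ 3) (\<lambda>k. l * perturbed \<phi> \<epsilon> k)"
proof -
  note pos = perturbed_pos[OF \<phi> \<open>\<epsilon> > 0\<close>]
  have l: "l > 0" and l2: "l ^ 2 * (1 + 2 * cos \<phi>) = 1"
    using cos_bounds[OF \<phi>] by (simp_all add: l_def power_divide)
  have "l * perturbed \<phi> \<epsilon> (k + 2) * (l * perturbed \<phi> \<epsilon> k)
      = 1 + - 2 * cos \<phi> * l ^ 3 / (l * perturbed \<phi> \<epsilon> (k + 1))" for k
  proof -
    have "perturbed \<phi> \<epsilon> (k + 2) * perturbed \<phi> \<epsilon> k
        = 1 + 2 * cos \<phi> - 2 * cos \<phi> / perturbed \<phi> \<epsilon> (k + 1)"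
      using pos[of k] by simp
    then have "l * perturbed \<phi> \<epsilon> (k + 2) * (l * perturbed \<phi> \<epsilon> k)
        = l ^ 2 * (1 + 2 * cos \<phi> - 2 * cos \<phi> / perturbed \<phi> \<epsilon> (k + 1))"
      by (metis mult.assoc mult.left_commute power2_eq_square)
    also have "\<dots> = l ^ 2 * (1 + 2 * cos \<phi>) - l ^ 2 * (2 * cos \<phi> / perturbed \<phi> \<epsilon> (k + 1))"
      by (rule right_diff_distrib)
    also have "\<dots> = 1 + - 2 * cos \<phi> * l ^ 3 / (l * perturbed \<phi> \<epsilon> (k + 1))"
      using pos[of "k + 1"] l unfolding l2 by (simp add: field_simps power2_eq_square power3_eq_cube)
    finally show ?thesis .
  qed
  then show ?thesis
    using pos l by (simp add: orbit_def)
qed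

lemma continuous_on_perturbed:
  assumes "\<epsilon> > 0" and S: "S \<subseteq> {pi / 2<..<2 * pi / 3}"
  shows "continuous_on S (\<lambda>\<phi>. perturbed \<phi> \<epsilon> k)"
proof (induction k rule: induct_nat_012)
  case (ge2 k)
  have "\<forall>\<phi>\<in>S. perturbed \<phi> \<epsilon> i \<noteq> 0" for i
    using perturbed_pos[OF _ \<open>\<epsilon> > 0\<close>, of _ i] S by (metis less_irrefl subsetD)
  with ge2 show ?case
    by (auto intro!: continuous_intros)
qed (auto intro!: continuous_intros)

text \<open>
  The limit is the solution of the linearized recurrence with initial values \<open>1, 1\<close>, a rotation by
  \<open>\<phi>0\<close> in symmetric form. Letting \<open>\<phi>\<close> and \<open>\<epsilon>\<close> both vary along an arbitrary filter serves two
  purposes: joint limits are used to exclude shorter periods, and limits with \<open>\<phi>\<close> fixed to determine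
  signs.
\<close>

lemma perturbed_linearization:
  assumes \<phi>: "(\<phi> \<longlongrightarrow> \<phi>0) F" and \<epsilon>: "(\<epsilon> \<longlongrightarrow> 0) F" "\<forall>\<^sub>F i in F. \<epsilon> i \<noteq> (0::real)"
    and half: "cos (\<phi>0 / 2) \<noteq> 0"
  shows "((\<lambda>i. (perturbed (\<phi> i) (\<epsilon> i) k - 1) / \<epsilon> i) \<longlongrightarrow>
           cos ((real k - 1 / 2) * \<phi>0) / cos (\<phi>0 / 2)) F"
proof -
  define E where "E k i = (perturbed (\<phi> i) (\<epsilon> i) k - 1) / \<epsilon> i" for k i
  define e where "e k = cos ((real k - 1 / 2) * \<phi>0) / cos (\<phi>0 / 2)" for k
  have e_rec: "e (Suc (Suc k)) = - e k + 2 * cos \<phi>0 * e (Suc k)" for k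
  proof -
    define x where "x = (real k + 1 / 2) * \<phi>0"
    have x: "(real k - 1 / 2) * \<phi>0 = x - \<phi>0" "(real (Suc k) - 1 / 2) * \<phi>0 = x"
      "(real (Suc (Suc k)) - 1 / 2) * \<phi>0 = x + \<phi>0"
      by (simp_all add: x_def algebra_simps)
    show ?thesis
      unfolding e_def x using half by (simp add: cos_add cos_diff field_simps)
  qed
  have E01: "(E k \<longlongrightarrow> e k) F" if "k = 0 \<or> k = Suc 0" for k
  proof (rule tendsto_eventually)
    have "e k = 1"
      using that half by (auto simp: e_def)
    then show "\<forall>\<^sub>F i in F. E k i = e k"
      using \<epsilon>(2) that by (auto simp: E_def elim!: eventually_mono)
  qed
  have "(E k \<longlongrightarrow> e k) F"
  proof (induction k rule: induct_nat_012)
    case (ge2 k)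
    have z1: "((\<lambda>i. perturbed (\<phi> i) (\<epsilon> i) j) \<longlongrightarrow> 1) F" if "(E j \<longlongrightarrow> e j) F" for j
    proof (rule Lim_transform_eventually)
      show "((\<lambda>i. 1 + \<epsilon> i * E j i) \<longlongrightarrow> 1) F"
        using tendsto_add[OF tendsto_const tendsto_mult[OF \<epsilon>(1) that], of 1] by simp
      show "\<forall>\<^sub>F i in F. 1 + \<epsilon> i * E j i = perturbed (\<phi> i) (\<epsilon> i) j"
        using \<epsilon>(2) by eventually_elim (simp add: E_def)
    qed
    note z = z1[OF ge2.IH(1)] z1[OF ge2.IH(2)]
    have nz: "\<forall>\<^sub>F i in F. perturbed (\<phi> i) (\<epsilon> i) k \<noteq> 0" "\<forall>\<^sub>F i in F. perturbed (\<phi> i) (\<epsilon> i) (Suc k) \<noteq> 0"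
      using z by (auto intro: tendsto_imp_eventually_ne)
    show ?case
    proof (rule Lim_transform_eventually)
      show "((\<lambda>i. (- E k i + 2 * cos (\<phi> i) * E (Suc k) i / perturbed (\<phi> i) (\<epsilon> i) (Suc k))
          / perturbed (\<phi> i) (\<epsilon> i) k) \<longlongrightarrow> e (Suc (Suc k))) F"
      proof -
        have "((\<lambda>i. 2 * cos (\<phi> i)) \<longlongrightarrow> 2 * cos \<phi>0) F"
          by (intro tendsto_mult tendsto_const isCont_tendsto_compose[OF isCont_cos] \<phi>)
        from tendsto_divide[OF tendsto_add[OF tendsto_minus[OF ge2.IH(1)]
            tendsto_divide[OF tendsto_mult[OF this ge2.IH(2)] z(2)]] z(1)]
        show ?thesis by (simp add: e_rec)
      qed
      show "\<forall>\<^sub>F i in F. (- E k i + 2 * cos (\<phi> i) * E (Suc k) i / perturbed (\<phi> i) (\<epsilon> i) (Suc k))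
          / perturbed (\<phi> i) (\<epsilon> i) k = E (Suc (Suc k)) i"
        using \<epsilon>(2) nz by eventually_elim (simp add: E_def field_simps)
    qed
  qed (simp_all add: E01)
  then show ?thesis
    unfolding E_def e_def .
qed


section \<open>Periodic orbits near a rational rotation\<close>

lemma sin_near_rotation:
  assumes "q > 0" and "\<phi> = pi * real p / real q + \<eta>"
  shows "sin (real q * \<phi>) = (- 1) ^ p * sin (real q * \<eta>)"
proof -
  have "real q * \<phi> = pi * real p + real q * \<eta>"
    using assms by (simp add: field_simps)
  then show ?thesis
    by (simp add: sin_add cos_npi2)
qed

text \<open>
  The two equalities together would say that the rotation by \<open>2 r \<phi>\<close> fixes a nonzero vector, so that
  \<open>r p / q\<close> would be an integer.
\<close>

lemma no_early_return:
  assumes "coprime p q" "0 < r" "r < q" and \<phi>: "\<phi> = pi * real p / real q"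
    and half: "cos (\<phi> / 2) \<noteq> 0" and "sin (\<phi> / 2) \<noteq> 0"
  shows "cos ((2 * real r - 1 / 2) * \<phi>) \<noteq> cos (\<phi> / 2) \<or>
         cos ((2 * real r + 1 / 2) * \<phi>) \<noteq> cos (\<phi> / 2)"
proof (rule ccontr)
  define x where "x = 2 * real r * \<phi>"
  assume "\<not> ?thesis"
  moreover have "(2 * real r - 1 / 2) * \<phi> = x - \<phi> / 2" "(2 * real r + 1 / 2) * \<phi> = x + \<phi> / 2"
    by (simp_all add: x_def algebra_simps)
  ultimately have eq: "cos (x - \<phi> / 2) = cos (\<phi> / 2)" "cos (x + \<phi> / 2) = cos (\<phi> / 2)"
    by simp_all
  then have "2 * (cos x * cos (\<phi> / 2)) = 2 * cos (\<phi> / 2)"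
    unfolding cos_add cos_diff by linarith
  then have "cos x = 1"
    using half by simp
  then obtain j :: int where "x = 2 * pi * of_int j"
    by (auto simp: cos_one_2pi_int mult_ac)
  then have "real r * real p = of_int j * real q"
    using \<open>r < q\<close> by (simp add: x_def \<phi> field_simps)
  then have "int (r * p) = j * int q"
    by (metis of_int_eq_iff of_int_mult of_int_of_nat_eq of_nat_mult)
  then have "int q dvd int (r * p)"
    by simp
  then have "q dvd r"
    using \<open>coprime p q\<close> by (simp add: coprime_commute coprime_dvd_mult_left_iff)
  then show False
    using \<open>0 < r\<close> \<open>r < q\<close> by (simp add: dvd_imp_le leD)
qed

text \<open>
  The order of choices matters. The joint limit first provides a neighbourhood of \<open>(\<phi>s, 0)\<close> in which
  no orbit closes up early; an interval of half-width \<open>\<delta>\<close> around \<open>\<phi>s\<close> is taken inside it; only then is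
  \<open>\<epsilon>\<close> made small enough for the first-order term to decide the sign of the gap at both endpoints.
\<close>

lemma minimal_period_near_rotation:
  assumes "coprime p q" "0 < q" and \<phi>s: "\<phi>s = pi * real p / real q" "\<phi>s \<in> {pi / 2<..<2 * pi / 3}"
  shows "\<exists>\<phi>\<in>{pi / 2<..<2 * pi / 3}. \<exists>\<epsilon>>0. perturbed \<phi> \<epsilon> (q + 1) = perturbed \<phi> \<epsilon> q \<and>
    (\<forall>r. 0 < r \<and> r < q \<longrightarrow> perturbed \<phi> \<epsilon> (2 * r) \<noteq> 1 + \<epsilon> \<or> perturbed \<phi> \<epsilon> (2 * r + 1) \<noteq> 1 + \<epsilon>)"
proof -
  have half: "cos (\<phi> / 2) > 0" "sin (\<phi> / 2) > 0" if "\<phi> \<in> {pi / 2<..<2 * pi / 3}" for \<phi>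
    using that by (auto intro!: cos_gt_zero_pi sin_gt_zero)
  define noret where "noret \<phi> \<epsilon> \<longleftrightarrow> (\<forall>r\<in>{0<..<q}.
     perturbed \<phi> \<epsilon> (2 * r) \<noteq> 1 + \<epsilon> \<or> perturbed \<phi> \<epsilon> (2 * r + 1) \<noteq> 1 + \<epsilon>)" for \<phi> \<epsilon>
  have "\<forall>\<^sub>F (\<phi>, \<epsilon>) in nhds \<phi>s \<times>\<^sub>F at_right 0. noret \<phi> \<epsilon>"
    unfolding noret_def case_prod_beta
  proof (rule eventually_ball_finite[OF _ ballI])
    let ?F = "nhds \<phi>s \<times>\<^sub>F at_right (0::real)"
    fix r assume r: "r \<in> {0<..<q}"
    have lim_fst: "(fst \<longlongrightarrow> \<phi>s) ?F"
      by (rule filterlim_fst)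
    have snd: "filterlim snd (at_right 0) ?F"
      by (rule filterlim_snd)
    then have lim_snd: "(snd \<longlongrightarrow> 0) ?F" and ne: "\<forall>\<^sub>F x in ?F. snd x \<noteq> 0"
      by (auto simp: filterlim_at elim: eventually_mono)
    note lin = perturbed_linearization[OF lim_fst lim_snd ne, OF less_imp_neq[OF half(1)[OF \<phi>s(2)], symmetric]]
    have away: "\<forall>\<^sub>F x in ?F. perturbed (fst x) (snd x) k \<noteq> 1 + snd x"
      if "cos ((real k - 1 / 2) * \<phi>s) / cos (\<phi>s / 2) \<noteq> 1" for k
      using tendsto_imp_eventually_ne[OF lin that] ne by eventually_elim auto
    have "cos ((real (2 * r) - 1 / 2) * \<phi>s) / cos (\<phi>s / 2) \<noteq> 1 \<or>
          cos ((real (2 * r + 1) - 1 / 2) * \<phi>s) / cos (\<phi>s / 2) \<noteq> 1"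
      using no_early_return[OF \<open>coprime p q\<close> _ _ \<phi>s(1), of r] half[OF \<phi>s(2)] r
      by (auto simp: algebra_simps)
    then show "\<forall>\<^sub>F x in ?F. perturbed (fst x) (snd x) (2 * r) \<noteq> 1 + snd x \<or>
        perturbed (fst x) (snd x) (2 * r + 1) \<noteq> 1 + snd x"
    proof (elim disjE)
      assume "cos ((real (2 * r) - 1 / 2) * \<phi>s) / cos (\<phi>s / 2) \<noteq> 1"
      from away[OF this] show ?thesis by eventually_elim simp
    next
      assume "cos ((real (2 * r + 1) - 1 / 2) * \<phi>s) / cos (\<phi>s / 2) \<noteq> 1"
      from away[OF this] show ?thesis by eventually_elim simp
    qed
  qed simp
  then obtain A B where A: "eventually A (nhds \<phi>s)" and B: "eventually B (at_right 0)"
    and AB: "\<And>\<phi> \<epsilon>. A \<phi> \<Longrightarrow> B \<epsilon> \<Longrightarrow> noret \<phi> \<epsilon>"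
    unfolding eventually_prod_filter by auto
  have "\<forall>\<^sub>F \<phi> in nhds \<phi>s. A \<phi> \<and> \<phi> \<in> {pi / 2<..<2 * pi / 3}"
    by (intro eventually_conj A eventually_nhds_in_open \<phi>s(2)) simp
  then obtain \<delta>0 where "\<delta>0 > 0"
    and \<delta>0: "\<And>\<phi>. dist \<phi> \<phi>s < \<delta>0 \<Longrightarrow> A \<phi> \<and> \<phi> \<in> {pi / 2<..<2 * pi / 3}"
    unfolding eventually_nhds_metric by blast
  \<comment> \<open>The bound \<open>q \<delta> < \<pi>\<close> makes \<open>\<phi>s\<close> the only zero of \<open>sin (q \<phi>)\<close> in the interval.\<close>
  define \<delta> where "\<delta> = min (\<delta>0 / 2) (pi / (2 * real q))"
  have "\<delta> > 0" "\<delta> \<le> \<delta>0 / 2" "\<delta> \<le> pi / (2 * real q)"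
    using \<open>\<delta>0 > 0\<close> \<open>0 < q\<close> by (simp_all add: \<delta>_def)
  moreover from this(3) have "real q * \<delta> \<le> pi / 2"
    using \<open>0 < q\<close> by (simp add: field_simps)
  ultimately have \<delta>: "\<delta> > 0" "\<delta> < \<delta>0" "real q * \<delta> < pi"
    using pi_gt_zero by linarith+
  have near: "A \<phi> \<and> \<phi> \<in> {pi / 2<..<2 * pi / 3}" if "\<phi> \<in> {\<phi>s - \<delta>..\<phi>s + \<delta>}" for \<phi>
    using that \<delta> by (intro \<delta>0) (auto simp: dist_real_def)
  \<comment> \<open>The factor \<open>(- 1) ^ p\<close> cancels the sign in \<open>sin (q (\<phi>s + \<eta>)) = (- 1) ^ p sin (q \<eta>)\<close>, so that
    \<open>g\<close> goes from positive to negative for every \<open>p\<close>.\<close>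
  define g where "g \<phi> \<epsilon> = (- 1) ^ p * (perturbed \<phi> \<epsilon> (q + 1) - perturbed \<phi> \<epsilon> q)" for \<phi> \<epsilon>
  have g_lim: "((\<lambda>\<epsilon>. g (\<phi>s + \<eta>) \<epsilon> / \<epsilon>) \<longlongrightarrow>
      - 2 * sin (real q * \<eta>) * sin ((\<phi>s + \<eta>) / 2) / cos ((\<phi>s + \<eta>) / 2)) (at_right 0)"
    if "\<bar>\<eta>\<bar> \<le> \<delta>" for \<eta>
  proof -
    let ?\<phi> = "\<phi>s + \<eta>"
    have c: "cos (?\<phi> / 2) \<noteq> 0"
    proof -
      have "?\<phi> \<in> {\<phi>s - \<delta>..\<phi>s + \<delta>}"
        using that by (simp add: abs_le_iff)
      from half(1)[OF conjunct2[OF near[OF this]]] show ?thesis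
        by simp
    qed
    have ne: "\<forall>\<^sub>F \<epsilon> in at_right 0. \<epsilon> \<noteq> (0::real)"
      by (simp add: eventually_at_filter)
    note lin = perturbed_linearization[OF tendsto_const tendsto_ident_at ne c]
    have lim: "((\<lambda>\<epsilon>. (- 1) ^ p * ((perturbed ?\<phi> \<epsilon> (q + 1) - 1) / \<epsilon> - (perturbed ?\<phi> \<epsilon> q - 1) / \<epsilon>)) \<longlongrightarrow>
       (- 1) ^ p * (cos ((real (q + 1) - 1 / 2) * ?\<phi>) / cos (?\<phi> / 2)
          - cos ((real q - 1 / 2) * ?\<phi>) / cos (?\<phi> / 2))) (at_right 0)"
      by (intro tendsto_intros lin)
    have coefficient: "(- 1) ^ p * (cos ((real (q + 1) - 1 / 2) * ?\<phi>) / cos (?\<phi> / 2)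
          - cos ((real q - 1 / 2) * ?\<phi>) / cos (?\<phi> / 2))
        = - 2 * sin (real q * \<eta>) * sin (?\<phi> / 2) / cos (?\<phi> / 2)"
    proof -
      have "(real (q + 1) - 1 / 2) * ?\<phi> = real q * ?\<phi> + ?\<phi> / 2"
        "(real q - 1 / 2) * ?\<phi> = real q * ?\<phi> - ?\<phi> / 2"
        by (simp_all add: algebra_simps)
      then have "cos ((real (q + 1) - 1 / 2) * ?\<phi>) - cos ((real q - 1 / 2) * ?\<phi>)
          = - 2 * (- 1) ^ p * sin (real q * \<eta>) * sin (?\<phi> / 2)"
        using sin_near_rotation[OF \<open>0 < q\<close>, of ?\<phi> p \<eta>] \<phi>s(1) by (simp add: cos_add cos_diff)
      then have "(- 1) ^ p * (cos ((real (q + 1) - 1 / 2) * ?\<phi>) - cos ((real q - 1 / 2) * ?\<phi>))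
          = (- 1) ^ p * (- 2 * (- 1) ^ p * sin (real q * \<eta>) * sin (?\<phi> / 2))"
        by (simp only:)
      also have "\<dots> = - 2 * sin (real q * \<eta>) * sin (?\<phi> / 2) * ((- 1) ^ p * (- 1) ^ p)"
        by (simp only: mult_ac)
      also have "(- 1 :: real) ^ p * (- 1) ^ p = 1"
        by (simp flip: power_mult_distrib)
      finally show ?thesis
        by (simp only: diff_divide_distrib[symmetric] times_divide_eq_right mult_1_right)
    qed
    have quotient: "(\<lambda>\<epsilon>. (- 1) ^ p * ((perturbed ?\<phi> \<epsilon> (q + 1) - 1) / \<epsilon> - (perturbed ?\<phi> \<epsilon> q - 1) / \<epsilon>))
        = (\<lambda>\<epsilon>. g ?\<phi> \<epsilon> / \<epsilon>)"
      by (simp add: g_def fun_eq_iff flip: diff_divide_distrib)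
    show ?thesis
      using lim unfolding coefficient quotient .
  qed
  have sq: "sin (real q * \<delta>) > 0"
    using \<delta> \<open>0 < q\<close> by (intro sin_gt_zero) auto
  have hl: "cos ((\<phi>s - \<delta>) / 2) > 0" "sin ((\<phi>s - \<delta>) / 2) > 0"
    and hr: "cos ((\<phi>s + \<delta>) / 2) > 0" "sin ((\<phi>s + \<delta>) / 2) > 0"
    using half[of "\<phi>s - \<delta>"] half[of "\<phi>s + \<delta>"] near[of "\<phi>s - \<delta>"] near[of "\<phi>s + \<delta>"] \<delta>(1) by auto
  have "- 2 * sin (real q * - \<delta>) * sin ((\<phi>s + - \<delta>) / 2) / cos ((\<phi>s + - \<delta>) / 2) > 0"
    using sq hl by simp
  from order_tendstoD(1)[OF g_lim this] have "\<forall>\<^sub>F \<epsilon> in at_right 0. g (\<phi>s - \<delta>) \<epsilon> / \<epsilon> > 0"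
    using \<delta>(1) by simp
  moreover have "- 2 * sin (real q * \<delta>) * sin ((\<phi>s + \<delta>) / 2) / cos ((\<phi>s + \<delta>) / 2) < 0"
    using sq hr by simp
  from order_tendstoD(2)[OF g_lim this] have "\<forall>\<^sub>F \<epsilon> in at_right 0. g (\<phi>s + \<delta>) \<epsilon> / \<epsilon> < 0"
    using \<delta>(1) by simp
  moreover have "\<forall>\<^sub>F \<epsilon> in at_right 0. (0::real) < \<epsilon>"
    by (simp add: eventually_at_filter)
  ultimately have "\<forall>\<^sub>F \<epsilon> in at_right 0. 0 < \<epsilon> \<and> B \<epsilon> \<and> g (\<phi>s - \<delta>) \<epsilon> > 0 \<and> g (\<phi>s + \<delta>) \<epsilon> < 0"
    using B by eventually_elim (auto simp: zero_less_divide_iff divide_less_0_iff)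
  then obtain \<epsilon> where \<epsilon>: "0 < \<epsilon>" "B \<epsilon>" "g (\<phi>s - \<delta>) \<epsilon> > 0" "g (\<phi>s + \<delta>) \<epsilon> < 0"
    using eventually_happens'[OF trivial_limit_at_right_real] by blast
  have "continuous_on {\<phi>s - \<delta>..\<phi>s + \<delta>} (\<lambda>\<phi>. g \<phi> \<epsilon>)"
    unfolding g_def using near by (intro continuous_intros continuous_on_perturbed \<epsilon>(1)) blast+
  then obtain \<phi> where \<phi>: "\<phi> \<in> {\<phi>s - \<delta>..\<phi>s + \<delta>}" "g \<phi> \<epsilon> = 0"
    using IVT2'[of "\<lambda>\<phi>. g \<phi> \<epsilon>" "\<phi>s + \<delta>" 0 "\<phi>s - \<delta>"] \<epsilon> \<delta>(1) by auto
  then have "perturbed \<phi> \<epsilon> (q + 1) = perturbed \<phi> \<epsilon> q"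
    by (simp add: g_def)
  moreover have "noret \<phi> \<epsilon>"
    using AB near \<phi>(1) \<epsilon>(2) by blast
  ultimately show ?thesis
    using near[OF \<phi>(1)] \<epsilon>(1)
    by (intro bexI[of _ \<phi>] exI[of _ \<epsilon>] conjI allI impI) (simp_all add: noret_def)
qed

lemma exists_solution_minimal_period:
  assumes "coprime p q" "q < 2 * p" "3 * p < 2 * q"
  shows "\<exists>d>0. \<exists>u v. solution d u v \<and> minimal_period q (\<lambda>n. (u n, v n))"
proof -
  have "0 < q" using assms by linarith
  moreover have "pi * real p / real q \<in> {pi / 2<..<2 * pi / 3}"
    using \<open>0 < q\<close> assms(2,3) by (simp add: field_simps)
  ultimately obtain \<phi> \<epsilon> where \<phi>: "\<phi> \<in> {pi / 2<..<2 * pi / 3}" and "\<epsilon> > 0"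
    and ret: "perturbed \<phi> \<epsilon> (q + 1) = perturbed \<phi> \<epsilon> q"
    and noret: "\<And>r. 0 < r \<Longrightarrow> r < q \<Longrightarrow>
       perturbed \<phi> \<epsilon> (2 * r) \<noteq> 1 + \<epsilon> \<or> perturbed \<phi> \<epsilon> (2 * r + 1) \<noteq> 1 + \<epsilon>"
    using minimal_period_near_rotation[OF \<open>coprime p q\<close> _ refl] by blast
  define l where "l = 1 / sqrt (1 + 2 * cos \<phi>)"
  define d where "d = - 2 * cos \<phi> * l ^ 3"
  define w where "w k = l * perturbed \<phi> \<epsilon> k" for k
  define u v where "u n = w (2 * n)" and "v n = w (Suc (2 * n))" for n
  have "l > 0" "d > 0"
    using cos_bounds[OF \<phi>] by (simp_all add: d_def l_def mult_neg_pos)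
  have w: "orbit d w"
    unfolding d_def w_def l_def by (rule orbit_perturbed[OF \<phi> \<open>\<epsilon> > 0\<close>])
  have uv: "interleave u v = w"
    unfolding u_def v_def by (rule interleave_split)
  have "has_period (2 * q) w"
    by (rule orbit_symmetric_period[OF w]) (use ret \<open>0 < q\<close> in \<open>simp_all add: w_def\<close>)
  moreover have "q \<le> r" if "has_period (2 * r) w" for r
  proof (rule ccontr)
    assume "\<not> q \<le> r"
    moreover have "r > 0" "w (0 + 2 * r) = w 0" "w (1 + 2 * r) = w 1"
      using that by (simp_all only: has_period_def) simp
    ultimately show False
      using noret[of r] \<open>l > 0\<close> by (simp add: w_def)
  qed
  ultimately have "minimal_period q (\<lambda>n. (u n, v n))"
    unfolding minimal_period_def by (metis uv has_period_interleave_iff)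
  moreover have "solution d u v"
    using w by (simp add: solution_iff_orbit uv)
  ultimately show ?thesis
    using \<open>d > 0\<close> by blast
qed

text \<open>
  The witness is the smallest integer above \<open>q/2\<close> that is prime to \<open>q\<close>: \<open>(q + 1)/2\<close> for odd \<open>q\<close>,
  \<open>q/2 + 1\<close> if \<open>4\<close> divides \<open>q\<close>, and \<open>q/2 + 2\<close> otherwise.
\<close>

lemma exists_coprime_numerator:
  fixes q :: nat
  assumes "q \<ge> 11 \<or> q \<in> {5, 7, 8, 9}"
  shows "\<exists>p. coprime p q \<and> q < 2 * p \<and> 3 * p < 2 * q"
proof (cases "odd q")
  case True
  then obtain m where q: "q = 2 * m + 1" by (elim oddE)
  have "gcd (m + 1) q = gcd (m + 1) (q - (m + 1))"
    by (metis gcd_diff1_nat gcd.commute q le_add2 add_mono mult_2 add_le_mono1 le_add1)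
  also have "\<dots> = 1"
    by (simp add: q)
  finally have "coprime (m + 1) q"
    by (simp add: coprime_iff_gcd_eq_1)
  then show ?thesis
    using assms by (intro exI[of _ "m + 1"]) (auto simp: q)
next
  case False
  then obtain m where q: "q = 2 * m" by (metis evenE)
  show ?thesis
  proof (cases "even m")
    case True
    have "coprime (m + 1) q"
      using True by (simp add: q coprime_mult_right_iff coprime_right_2_iff_odd)
    moreover have "m \<ge> 4"
      using assms True unfolding q by (simp; elim disjE; presburger)
    ultimately show ?thesis
      by (intro exI[of _ "m + 1"]) (auto simp: q)
  next
    case False
    have "coprime (m + 2) m"
    proof (rule coprimeI)
      fix c assume "c dvd m + 2" "c dvd m"
      moreover from this have "c dvd 2"
        by (simp only: dvd_add_right_iff)
      moreover have "coprime 2 m"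
        using False by simp
      ultimately show "is_unit c"
        using coprime_common_divisor by blast
    qed
    then have "coprime (m + 2) q"
      using False by (simp add: q coprime_mult_right_iff coprime_right_2_iff_odd)
    moreover have "m \<ge> 7"
      using assms False unfolding q by (simp; elim disjE; presburger)
    ultimately show ?thesis
      by (intro exI[of _ "m + 2"]) (auto simp: q)
  qed
qed

theorem theorem16:
  shows "(\<forall>q\<ge>11. \<exists>d>0. \<exists>u v. solution d u v \<and> minimal_period q (\<lambda>n. (u n, v n)))
    \<and> (\<forall>q\<in>{2,3,4,6,10}. \<forall>d>0. \<not> (\<exists>u v. solution d u v
          \<and> \<not> (\<lambda>n. (u n, v n)) constant_on UNIV \<and> minimal_period q (\<lambda>n. (u n, v n))))
    \<and> (\<forall>q\<in>{5,7,8,9}. \<exists>d>0. \<exists>u v. solution d u v \<and> minimal_period q (\<lambda>n. (u n, v n)))"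
proof (intro conjI)
  have ex: "\<exists>d>0. \<exists>u v. solution d u v \<and> minimal_period q (\<lambda>n. (u n, v n))"
    if "q \<ge> 11 \<or> q \<in> {5, 7, 8, 9}" for q
    using exists_coprime_numerator[OF that] exists_solution_minimal_period by blast
  then show "\<forall>q\<ge>11. \<exists>d>0. \<exists>u v. solution d u v \<and> minimal_period q (\<lambda>n. (u n, v n))"
    and "\<forall>q\<in>{5,7,8,9}. \<exists>d>0. \<exists>u v. solution d u v \<and> minimal_period q (\<lambda>n. (u n, v n))"
    by blast+
  show "\<forall>q\<in>{2,3,4,6,10}. \<forall>d>0. \<not> (\<exists>u v. solution d u v
          \<and> \<not> (\<lambda>n. (u n, v n)) constant_on UNIV \<and> minimal_period q (\<lambda>n. (u n, v n)))"
  proof (intro ballI allI impI notI, elim exE conjE)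
    fix q :: nat and d :: real and u v
    assume q: "q \<in> {2, 3, 4, 6, 10}" and "d > 0" "solution d u v"
      and "minimal_period q (\<lambda>n. (u n, v n))"
    then have "q \<le> (if q = 10 then 5 else 1)"
      using solution_excluded_periods[of d u v q] unfolding minimal_period_def by blast
    then show False
      using q by auto
  qed
qed

end
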